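(* Let $x\in[0,1]$, let $b,s$ be positive integers and let $n$ be a nonnegative integer with $n\ge bs$. Then $$\mathfrak{S}_{n}(bs,x)=x\,\mathfrak{S}_{n-1}(bs-1,x)+(1-x)\,\mathfrak{S}_{n-1}(bs,x).$$
   Context: For positive integers $b,s$ and $x\in[0,1]$, the polynomials $\mathfrak{S}_n(bs,x)$ ($n\ge 0$) are defined by the generating function $$\frac{2^{b}x^{bs}\left(\frac{t}{2}\right)^{bs}e^{t(1-x)}}{(bs)!}=\sum_{n=0}^{\infty}\mathfrak{S}_{n}(bs,x)\frac{t^{n}}{n!},\qquad t\in\mathbb{C}.$$ Here $\mathfrak{S}_n(bs,x)$ depends on the pair $(b,s)$, not only on the product $bs$. For the same fixed pair $(b,s)$, the polynomials $\mathfrak{S}_n(bs-1,x)$ are obtained by lowering the index $bs$ to $bs-1$ while keeping the constant factor $2^{b(1-s)}$: $$2^{b(1-s)}\frac{x^{bs-1}t^{bs-1}e^{t(1-x)}}{(bs-1)!}=\sum_{n=0}^{\infty}\mathfrak{S}_{n}(bs-1,x)\frac{t^{n}}{n!}.$$ The convention $0^0=1$ is used. *)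

theory Defs
  imports "HOL-Analysis.Analysis" "HOL-Computational_Algebra.Polynomial"
begin

definition is_egf_of :: "(real \<Rightarrow> complex \<Rightarrow> complex) \<Rightarrow> (nat \<Rightarrow> real poly) \<Rightarrow> bool" where
  "is_egf_of G P \<longleftrightarrow> (\<forall>x\<in>{0..1}. \<forall>t::complex.
     (\<lambda>n. complex_of_real (poly (P n) x) * (t ^ n / fact n)) sums G x t)"

definition frakS_gen :: "nat \<Rightarrow> nat \<Rightarrow> real \<Rightarrow> complex \<Rightarrow> complex" where
  "frakS_gen b s x t =
     2 ^ b * complex_of_real x ^ (b * s) * (t / 2) ^ (b * s) * exp (t * (1 - complex_of_real x))
       / fact (b * s)"

(* The exponent b(1-s) is never positive when s is, hence the integer power. *)
definition frakS_low_gen :: "nat \<Rightarrow> nat \<Rightarrow> real \<Rightarrow> complex \<Rightarrow> complex" where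
  "frakS_low_gen b s x t =
     2 powi (int b * (1 - int s)) *
     (complex_of_real x ^ (b * s - 1) * t ^ (b * s - 1) * exp (t * (1 - complex_of_real x))
       / fact (b * s - 1))"

(* frakS b s n is the polynomial S_n(bs, .) and frakS_low b s n is S_n(bs - 1, .) for the same
   pair (b, s). Both depend on b and s separately. The descriptions are well defined by
   frakS_ex1 and frakS_low_ex1 below. *)
definition frakS :: "nat \<Rightarrow> nat \<Rightarrow> nat \<Rightarrow> real poly" where
  "frakS b s = (THE P. is_egf_of (frakS_gen b s) P)"

definition frakS_low :: "nat \<Rightarrow> nat \<Rightarrow> nat \<Rightarrow> real poly" where
  "frakS_low b s = (THE P. is_egf_of (frakS_low_gen b s) P)"

lemma is_egf_of_unique:
  assumes "is_egf_of G P" "is_egf_of G Q"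
  shows "P = Q"
proof
  fix n
  have eq: "poly (P n) x = poly (Q n) x" if x: "x \<in> {0..1}" for x
  proof -
    define f where "f R = Abs_fps (\<lambda>n. complex_of_real (poly (R n) x) / fact n)"
      for R :: "nat \<Rightarrow> real poly"
    have S: "(\<lambda>n. fps_nth (f R) n * t ^ n) sums G x t" if "is_egf_of G R" for R t
      using that x by (auto simp: is_egf_of_def f_def)
    have radius: "fps_conv_radius (f R) > 0" if "is_egf_of G R" for R
    proof -
      have "summable (\<lambda>n. fps_nth (f R) n * 1 ^ n)"
        using S[OF that, of 1] by (rule sums_summable)
      from conv_radius_geI[OF this] show ?thesis
        by (auto simp: fps_conv_radius_def intro: less_le_trans[of 0 "ereal 1"])
    qed
    have eval: "eval_fps (f R) t = G x t" if "is_egf_of G R" for R t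
      using S[OF that, of t] unfolding eval_fps_def by (rule sums_unique[symmetric])
    have "f P = f Q"
      by (rule eval_fps_eqD) (use assms radius eval in auto)
    then have "fps_nth (f P) n = fps_nth (f Q) n" by simp
    then show ?thesis by (simp add: f_def)
  qed
  have "infinite {x. poly (P n - Q n) x = 0}"
    by (rule infinite_super[of "{0..1::real}"]) (auto simp: eq)
  then show "P n = Q n"
    using poly_roots_finite[of "P n - Q n"] by auto
qed

lemma is_egf_of_exists:
  fixes c :: real
  assumes "\<And>x t. G x t = complex_of_real c *
    (complex_of_real x ^ m * t ^ m * exp (t * (1 - complex_of_real x)) / fact m)"
  shows "\<exists>P. is_egf_of G P"
proof
  let ?P = "\<lambda>n. if n < m then 0 else
    smult (c * real (n choose m)) ([:0, 1:] ^ m * [:1, -1:] ^ (n - m)) :: real poly"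
  show "is_egf_of G ?P"
    unfolding is_egf_of_def
  proof (intro ballI allI)
    fix x :: real and t :: complex
    let ?y = "t * (1 - complex_of_real x)"
    let ?k = "complex_of_real c * (complex_of_real x ^ m * t ^ m / fact m)"
    let ?f = "\<lambda>n. complex_of_real (poly (?P n) x) * (t ^ n / fact n)"
    have "(\<lambda>k. ?k * (?y ^ k /\<^sub>R fact k)) sums (?k * exp ?y)"
      by (intro sums_mult exp_converges)
    moreover have "?k * (?y ^ k /\<^sub>R fact k) = ?f (k + m)" for k
    proof -
      define z where "z = 1 - complex_of_real x"
      have coeff: "complex_of_real (poly (?P (k + m)) x) =
          complex_of_real c * (fact (k + m) / (fact m * fact k)) * (complex_of_real x ^ m * z ^ k)"
        by (simp add: binomial_fact z_def)
      show ?thesis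
        unfolding coeff z_def[symmetric]
        by (simp add: power_add power_mult_distrib field_simps scaleR_conv_of_real)
    qed
    moreover have "?k * exp ?y = G x t"
      by (simp add: assms)
    ultimately have "(\<lambda>k. ?f (k + m)) sums G x t"
      by simp
    then show "?f sums G x t"
      by (subst (asm) sums_zero_iff_shift) auto
  qed
qed

lemma frakS_ex1: "\<exists>!P. is_egf_of (frakS_gen b s) P"
proof -
  have "frakS_gen b s x t = complex_of_real (2 ^ b / 2 ^ (b * s)) *
     (complex_of_real x ^ (b * s) * t ^ (b * s) * exp (t * (1 - complex_of_real x)) / fact (b * s))"
    for x t
    by (simp add: frakS_gen_def power_divide)
  from is_egf_of_exists[OF this] show ?thesis
    using is_egf_of_unique by blast
qed

lemma frakS_low_ex1: "\<exists>!P. is_egf_of (frakS_low_gen b s) P"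
proof -
  have "frakS_low_gen b s x t = complex_of_real (2 powi (int b * (1 - int s))) *
     (complex_of_real x ^ (b * s - 1) * t ^ (b * s - 1) * exp (t * (1 - complex_of_real x))
        / fact (b * s - 1))"
    for x t
    by (simp add: frakS_low_gen_def of_real_power_int)
  from is_egf_of_exists[OF this] show ?thesis
    using is_egf_of_unique by blast
qed

end

theory Submission
  imports Defs
begin

text \<open>
  With \<open>m = b s\<close> and \<open>c = 2 ^ b / 2 ^ m = 2 powi (b (1 - s))\<close>, the two generating functions are
  \<open>F = c x ^ m t ^ m e ^ (t (1 - x)) / m!\<close> and the same expression \<open>L\<close> with \<open>m - 1\<close> in place
  of \<open>m\<close>. Since \<open>t ^ m / m!\<close> has derivative \<open>t ^ (m - 1) / (m - 1)!\<close>, the product rule gives the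
  differential equation \<open>dF/dt = x L + (1 - x) F\<close> (lemma \<open>frakS_gen_has_field_derivative\<close>).

  Differentiating an exponential generating function in \<open>t\<close> shifts its sequence of coefficients
  by one (lemma \<open>is_egf_of_derivative\<close>), while multiplication by a polynomial in \<open>x\<close> acts on each
  coefficient separately (lemma \<open>is_egf_of_combination\<close>). So both sides of the recurrence, as
  sequences of polynomials, have the same generating function, and the coefficient sequence of a
  generating function is unique.
\<close>

text \<open>
  A power series that converges on all of the complex plane may be differentiated termwise, and
  the derivative of \<open>t ^ (n + 1) / (n + 1)!\<close> is \<open>t ^ n / n!\<close>.
\<close>

lemma is_egf_of_derivative:
  assumes egf: "is_egf_of G P"
    and deriv: "\<And>x t. x \<in> {0..1} \<Longrightarrow> (G x has_field_derivative G' x t) (at t)"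
  shows "is_egf_of G' (\<lambda>n. P (Suc n))"
  unfolding is_egf_of_def
proof (intro ballI allI)
  fix x :: real and t :: complex
  assume x: "x \<in> {0..1}"
  define c where "c n = complex_of_real (poly (P n) x) / fact n" for n
  have S: "(\<lambda>n. c n * u ^ n) sums G x u" for u
    using egf x by (auto simp: is_egf_of_def c_def)
  have summable: "summable (\<lambda>n. c n * u ^ n)" for u
    using S by (rule sums_summable)
  have "G x = (\<lambda>u. \<Sum>n. c n * u ^ n)"
    using S by (auto intro: sums_unique)
  moreover have "((\<lambda>u. \<Sum>n. c n * u ^ n) has_field_derivative (\<Sum>n. diffs c n * t ^ n)) (at t)"
    by (rule termdiffs_strong_converges_everywhere) (rule summable)
  ultimately have "G' x t = (\<Sum>n. diffs c n * t ^ n)"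
    using deriv[OF x, of t] by (auto intro: DERIV_unique)
  moreover have "summable (\<lambda>n. diffs c n * t ^ n)"
    by (rule termdiff_converges_all) (rule summable)
  ultimately have "(\<lambda>n. diffs c n * t ^ n) sums G' x t"
    by (simp add: summable_sums)
  moreover have "diffs c n = complex_of_real (poly (P (Suc n)) x) / fact n" for n
    by (simp add: diffs_def c_def del: of_nat_Suc)
  ultimately show "(\<lambda>n. complex_of_real (poly (P (Suc n)) x) * (t ^ n / fact n)) sums G' x t"
    by simp
qed

lemma is_egf_of_combination:
  assumes "is_egf_of G P" "is_egf_of H Q"
  shows "is_egf_of
    (\<lambda>x t. complex_of_real (poly p x) * G x t + complex_of_real (poly q x) * H x t)
    (\<lambda>n. p * P n + q * Q n)"
  unfolding is_egf_of_def
proof (intro ballI allI)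
  fix x :: real and t :: complex
  assume x: "x \<in> {0..1}"
  have "(\<lambda>n. complex_of_real (poly p x) * (complex_of_real (poly (P n) x) * (t ^ n / fact n)) +
             complex_of_real (poly q x) * (complex_of_real (poly (Q n) x) * (t ^ n / fact n)))
        sums (complex_of_real (poly p x) * G x t + complex_of_real (poly q x) * H x t)"
    using assms x by (intro sums_add sums_mult) (auto simp: is_egf_of_def)
  then show "(\<lambda>n. complex_of_real (poly (p * P n + q * Q n) x) * (t ^ n / fact n))
        sums (complex_of_real (poly p x) * G x t + complex_of_real (poly q x) * H x t)"
    by (simp add: algebra_simps)
qed

lemma is_egf_of_frakS: "is_egf_of (frakS_gen b s) (frakS b s)"
  unfolding frakS_def by (rule theI'[OF frakS_ex1])

lemma is_egf_of_frakS_low: "is_egf_of (frakS_low_gen b s) (frakS_low b s)"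
  unfolding frakS_low_def by (rule theI'[OF frakS_low_ex1])

text \<open>
  Since \<open>2 ^ b / 2 ^ (b s) = 2 powi (b (1 - s))\<close>, the two generating functions have the same
  constant factor. Hence the term of the product rule that differentiates the power of \<open>t\<close> is \<open>x\<close>
  times the lowered generating function, with no further constant.
\<close>

lemma frakS_gen_has_field_derivative:
  assumes "b > 0" "s > 0"
  shows "(frakS_gen b s x has_field_derivative
    complex_of_real x * frakS_low_gen b s x t + complex_of_real (1 - x) * frakS_gen b s x t) (at t)"
proof -
  obtain k where k: "b * s = Suc k"
    using assms by (metis gr0_implies_Suc nat_0_less_mult_iff)
  define c where "c = (2 ^ b / 2 ^ Suc k :: complex)"
  define z where "z = 1 - complex_of_real x"
  define y where "y = complex_of_real x"
  have c: "2 powi (int b * (1 - int s)) = c"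
  proof -
    have "int b * (1 - int s) = int b - int (Suc k)"
      unfolding k[symmetric] by (simp add: algebra_simps)
    then show ?thesis
      by (simp add: c_def power_int_diff del: of_nat_Suc power_Suc)
  qed
  have gen: "frakS_gen b s x = (\<lambda>t. c * y ^ Suc k / fact (Suc k) * (t ^ Suc k * exp (t * z)))"
    by (rule ext)
      (simp add: frakS_gen_def k c_def z_def y_def power_divide del: power_Suc fact_Suc)
  have low: "frakS_low_gen b s x t = c * (y ^ k * t ^ k * exp (t * z) / fact k)"
    by (simp add: frakS_low_gen_def k c z_def y_def)
  have "((\<lambda>t. t ^ Suc k) has_field_derivative of_nat (Suc k) * t ^ k) (at t)"
    using DERIV_power[OF DERIV_ident, where n = "Suc k"] by simp
  moreover have "((\<lambda>t. exp (t * z)) has_field_derivative z * exp (t * z)) (at t)"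
    by (auto intro!: derivative_eq_intros)
  ultimately have "((\<lambda>t. t ^ Suc k * exp (t * z)) has_field_derivative
      of_nat (Suc k) * t ^ k * exp (t * z) + z * (t ^ Suc k * exp (t * z))) (at t)"
    by (auto intro!: DERIV_cong[OF DERIV_mult] simp: algebra_simps simp del: power_Suc of_nat_Suc)
  then have "(frakS_gen b s x has_field_derivative c * y ^ Suc k / fact (Suc k) *
      (of_nat (Suc k) * t ^ k * exp (t * z) + z * (t ^ Suc k * exp (t * z)))) (at t)"
    unfolding gen by (rule DERIV_cmult)
  moreover have "c * y ^ Suc k / fact (Suc k) * (of_nat (Suc k) * t ^ k * exp (t * z)) =
      y * frakS_low_gen b s x t"
    by (simp add: low del: of_nat_Suc)
  moreover have "c * y ^ Suc k / fact (Suc k) * (z * (t ^ Suc k * exp (t * z))) =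
      z * frakS_gen b s x t"
    by (simp add: gen del: power_Suc fact_Suc)
  moreover have "complex_of_real (1 - x) = z"
    by (simp add: z_def)
  ultimately show ?thesis
    by (simp only: distrib_left y_def)
qed

theorem theorem3:
  fixes x :: real and b s n :: nat
  assumes "x \<in> {0..1}" and "b > 0" and "s > 0" and "n \<ge> b * s"
  shows "poly (frakS b s n) x =
    x * poly (frakS_low b s (n - 1)) x + (1 - x) * poly (frakS b s (n - 1)) x"
proof -
  let ?G' = "\<lambda>x t. complex_of_real (poly [:0, 1:] x) * frakS_low_gen b s x t +
    complex_of_real (poly [:1, -1:] x) * frakS_gen b s x t"
  have "is_egf_of ?G' (\<lambda>n. frakS b s (Suc n))"
    by (rule is_egf_of_derivative[OF is_egf_of_frakS])
      (use frakS_gen_has_field_derivative[OF assms(2,3)] in simp)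
  moreover have "is_egf_of ?G' (\<lambda>n. [:0, 1:] * frakS_low b s n + [:1, -1:] * frakS b s n)"
    by (rule is_egf_of_combination[OF is_egf_of_frakS_low is_egf_of_frakS])
  ultimately have rec: "(\<lambda>n. frakS b s (Suc n)) =
      (\<lambda>n. [:0, 1:] * frakS_low b s n + [:1, -1:] * frakS b s n)"
    by (rule is_egf_of_unique)
  have "0 < b * s"
    using assms(2,3) by simp
  with assms(4) have "n = Suc (n - 1)"
    by linarith
  then have "frakS b s n = [:0, 1:] * frakS_low b s (n - 1) + [:1, -1:] * frakS b s (n - 1)"
    using fun_cong[OF rec, of "n - 1"] by metis
  then show ?thesis
    by (simp add: algebra_simps)
qed

end
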